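(* Let $(\mathbb{X},\mathfrak{B})$ be a measurable space equipped with a scaling $(x,t)\mapsto tx$ by $\mathbb{R}_{++}=(0,\infty)$, and let $\alpha>0$. Suppose that there exist sets $U_k\in\mathfrak{B}$, $k\in\mathbb{N}$, such that (a) if $x\in U_k$, then $tx\in U_k$ for all $t\ge 1$; and (b) $\bigcup_{k\in\mathbb{N}}(0,\infty)U_k=\mathbb{X}$. Then the following are equivalent for a measure $\nu$ on $(\mathbb{X},\mathfrak{B})$. (i) The measure $\nu$ is a nontrivial (i.e. nonzero) $\alpha$-homogeneous measure with $\nu(U_k)<\infty$ for all $k\in\mathbb{N}$. (ii) The measure $\nu$ is the push-forward of the measure $\pi\otimes\theta_\alpha$ by the map $(x,t)\mapsto tx$ from $\mathbb{X}\times\mathbb{R}_{++}$ to $\mathbb{X}$, where $\pi$ is some probability measure on $(\mathbb{X},\mathfrak{B})$ such that $$\int_0^\infty \pi(tU_k)\,t^{\alpha-1}\,dt<\infty\quad\text{for all }k\in\mathbb{N},$$ and $\theta_\alpha$ is the measure on $\mathbb{R}_{++}$ given by $\theta_\alpha(dt)=\alpha t^{-(\alpha+1)}\,dt$. (iii) There is a probability measure $\pi$ on $(\mathbb{X},\mathfrak{B})$ such that $\int_0^\infty \pi(tU_k)\,t^{\alpha-1}\,dt<\infty$ for all $k\in\mathbb{N}$ and $$\nu(B)=\alpha\int_0^\infty \pi(tB)\,t^{\alpha-1}\,dt\quad\text{for all }B\in\mathfrak{B}.$$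
   Context: A scaling on a measurable space $(\mathbb{X},\mathfrak{B})$ is a map $(x,t)\mapsto tx\in\mathbb{X}$, $x\in\mathbb{X}$, $t\in\mathbb{R}_{++}:=(0,\infty)$, which is $\mathfrak{B}\otimes\mathcal{B}(\mathbb{R}_{++})/\mathfrak{B}$-measurable and is an action of the multiplicative group $\mathbb{R}_{++}$: $t(sx)=(ts)x$ and $1x=x$ for all $s,t>0$, $x\in\mathbb{X}$. For $B\subseteq\mathbb{X}$, $t>0$ and $I\subseteq\mathbb{R}_{++}$, put $tB:=\{tx:x\in B\}$ and $IB:=\bigcup_{t\in I}tB$. (If $B\in\mathfrak{B}$ then $tB\in\mathfrak{B}$.) A measure $\nu$ on $(\mathbb{X},\mathfrak{B})$ is $\alpha$-homogeneous if $\nu(sB)=s^{-\alpha}\nu(B)$ for all $B\in\mathfrak{B}$ and $s>0$. *)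

theory Defs
  imports "HOL-Probability.Probability"
begin

text \<open>
  A measurable space is represented by a value \<open>M\<close> of type \<^typ>\<open>'a measure\<close> of which only
  \<^term>\<open>space M\<close> and \<^term>\<open>sets M\<close> matter; a measure \<open>\<nu>\<close> on it satisfies
  \<^prop>\<open>sets \<nu> = sets M\<close>. The point \<open>tx\<close> is written \<open>sc t x\<close>, hence \<open>tB\<close> is \<open>sc t ` B\<close>.
  The values of \<open>sc\<close> for \<open>t \<le> 0\<close> or outside \<^term>\<open>space M\<close> are irrelevant; the measurability
  assumption includes that \<open>sc t\<close> maps \<^term>\<open>space M\<close> into itself for \<open>t > 0\<close>.
\<close>

locale scaling =
  fixes M :: "'a measure" and sc :: "real \<Rightarrow> 'a \<Rightarrow> 'a"
  assumes measurable_scaling: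
      "(\<lambda>(x, t). sc t x) \<in> M \<Otimes>\<^sub>M restrict_space borel {0<..} \<rightarrow>\<^sub>M M"
    and scaling_scaling:
      "\<And>s t x. 0 < s \<Longrightarrow> 0 < t \<Longrightarrow> x \<in> space M \<Longrightarrow> sc t (sc s x) = sc (t * s) x"
    and scaling_one: "\<And>x. x \<in> space M \<Longrightarrow> sc 1 x = x"
begin

lemma measurable_scaling_fixed:
  assumes "0 < t" shows "sc t \<in> M \<rightarrow>\<^sub>M M"
proof -
  have "(\<lambda>x. (x, t)) \<in> M \<rightarrow>\<^sub>M M \<Otimes>\<^sub>M restrict_space borel {0<..}"
    using assms by (intro measurable_Pair) (auto simp: space_restrict_space)
  from measurable_compose[OF this measurable_scaling] show ?thesis by simp
qed

text \<open>
  Since \<^const>\<open>emeasure\<close> is 0 on non-measurable sets, the following fact is needed for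
  \<open>\<nu>(tB)\<close> to have its intended meaning.
\<close>

lemma scaled_set_in_sets:
  assumes "0 < t" "B \<in> sets M"
  shows "sc t ` B \<in> sets M"
proof -
  have B: "B \<subseteq> space M" using assms(2) by (rule sets.sets_into_space)
  have closed: "sc s x \<in> space M" if "0 < s" "x \<in> space M" for s x
    using measurable_space[OF measurable_scaling_fixed[OF that(1)] that(2)] .
  have "sc t ` B = sc (inverse t) -` B \<inter> space M"
  proof (intro set_eqI iffI)
    fix y assume "y \<in> sc t ` B"
    then obtain x where x: "x \<in> B" "y = sc t x" by auto
    then have "sc (inverse t) y = x"
      using assms(1) B by (auto simp: scaling_scaling scaling_one)
    with x closed[OF assms(1)] B show "y \<in> sc (inverse t) -` B \<inter> space M" by auto
  next
    fix y assume y: "y \<in> sc (inverse t) -` B \<inter> space M"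
    then have "y = sc t (sc (inverse t) y)"
      using assms(1) by (simp add: scaling_scaling scaling_one)
    with y show "y \<in> sc t ` B" by blast
  qed
  then show ?thesis
    using measurable_sets[OF measurable_scaling_fixed assms(2)] assms(1) by simp
qed

end

definition homogeneous :: "(real \<Rightarrow> 'a \<Rightarrow> 'a) \<Rightarrow> real \<Rightarrow> 'a measure \<Rightarrow> bool" where
  "homogeneous sc \<alpha> \<nu> \<longleftrightarrow>
     (\<forall>B\<in>sets \<nu>. \<forall>s>0. emeasure \<nu> (sc s ` B) = ennreal (s powr (-\<alpha>)) * emeasure \<nu> B)"

definition theta :: "real \<Rightarrow> real measure" where
  "theta \<alpha> = density (restrict_space lborel {0<..}) (\<lambda>t. ennreal (\<alpha> * t powr (-(\<alpha> + 1))))"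

end

theory Submission
  imports Defs
begin

text \<open>
  The equivalence of (ii) and (iii) is Fubini together with the substitution \<open>t \<mapsto> 1/t\<close>, and (iii)
  implies (i) by the substitution \<open>t \<mapsto> ts\<close>. For (i) implies (iii), homogeneity allows one to replace
  the sets \<open>U k\<close> by a single upward closed set \<open>V\<close> with \<open>\<nu>(V) < \<infinity>\<close> whose multiples cover the space.
  Almost every orbit enters \<open>V\<close> at a positive time, so it spends multiplicative length \<open>ln 2\<close> in the
  shell \<open>A = V \<setminus> 2V\<close>. Hence the restriction of \<open>\<nu>\<close> to \<open>A\<close>, divided by \<open>\<alpha> ln 2\<close>, satisfies the formula
  in (iii), and it is a probability measure after rescaling \<open>V\<close>.
\<close>

section \<open>Integration over the positive half-line\<close>

text \<open>The restricted measure asks for measurability on the positive reals only; this matters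
  because \<open>sc t\<close> is unspecified for t \<le> 0.\<close>

abbreviation lborel_pos :: "real measure" where
  "lborel_pos \<equiv> restrict_space lborel {0<..}"

lemma nn_integral_lborel_pos:
  "(\<integral>\<^sup>+t. f t \<partial>lborel_pos) = (\<integral>\<^sup>+t\<in>{0<..}. f t \<partial>lborel)"
  by (rule nn_integral_restrict_space) simp

lemma borel_measurable_lborel_pos_iff:
  fixes f :: "real \<Rightarrow> ennreal"
  shows "f \<in> borel_measurable lborel_pos \<longleftrightarrow> (\<lambda>t. f t * indicator {0<..} t) \<in> borel_measurable borel"
  by (subst borel_measurable_restrict_space_iff_ennreal) simp_all

lemma nn_integral_lborel_pos_scale:
  fixes f :: "real \<Rightarrow> ennreal"
  assumes f: "f \<in> borel_measurable lborel_pos" and s: "0 < s"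
  shows "(\<integral>\<^sup>+t. f t \<partial>lborel_pos) = ennreal s * (\<integral>\<^sup>+t. f (s * t) \<partial>lborel_pos)"
proof -
  have "(\<integral>\<^sup>+t. f t \<partial>lborel_pos) = \<bar>s\<bar> * (\<integral>\<^sup>+t. f (0 + s * t) * indicator {0<..} (0 + s * t) \<partial>lborel)"
    unfolding nn_integral_lborel_pos
    using f s by (intro nn_integral_real_affine) (simp_all add: borel_measurable_lborel_pos_iff)
  also have "(\<integral>\<^sup>+t. f (0 + s * t) * indicator {0<..} (0 + s * t) \<partial>lborel) = (\<integral>\<^sup>+t. f (s * t) \<partial>lborel_pos)"
    unfolding nn_integral_lborel_pos
    using s by (intro nn_integral_cong) (auto simp: indicator_def zero_less_mult_iff)
  finally show ?thesis using s by simp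
qed

text \<open>The substitution rule applied here works on a compact interval with a nonnegative
  derivative. So the half-line is exhausted by compact intervals, and on each of them the decreasing
  inversion is split into the increasing map -1/t on the negative axis and a reflection.\<close>

lemma nn_integral_lborel_pos_inverse:
  fixes f :: "real \<Rightarrow> ennreal"
  assumes f: "f \<in> borel_measurable lborel_pos"
  shows "(\<integral>\<^sup>+t. f t \<partial>lborel_pos) = (\<integral>\<^sup>+t. f (inverse t) * ennreal (1 / t\<^sup>2) \<partial>lborel_pos)"
proof -
  define h where "h t = f t * indicator {0<..} t" for t
  have h[measurable]: "h \<in> borel_measurable borel"
    using f unfolding h_def borel_measurable_lborel_pos_iff .
  \<comment> \<open>Inversion maps each of these intervals onto itself. Adding 2 rather than 1 keeps
    the end points distinct at n = 0, as the substitution rule requires.\<close>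
  define I where "I n = {1 / (real n + 2)..real n + 2}" for n
  have I[measurable]: "I n \<in> sets borel" for n by (simp add: I_def)
  have I_inc: "incseq I"
    unfolding I_def by (intro incseq_SucI) (auto simp: field_simps intro: order_trans[rotated])
  have I_UN: "(\<Union>n. I n) = {0<..}"
  proof (intro set_eqI iffI)
    fix t :: real assume t: "t \<in> {0<..}"
    obtain n where n: "max t (1/t) < real n" using reals_Archimedean2 by blast
    have "1 / t \<le> real n + 2" "t \<le> real n + 2" using n by auto
    then have "t \<in> I n" using t by (auto simp: I_def field_simps)
    then show "t \<in> (\<Union>n. I n)" by blast
  next
    fix t assume "t \<in> (\<Union>n. I n)"
    then obtain n where "1 / (real n + 2) \<le> t" by (auto simp: I_def)
    moreover have "0 < 1 / (real n + 2)" by simp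
    ultimately show "t \<in> {0<..}" by (simp only: greaterThan_iff)
  qed
  have exhaust: "(\<integral>\<^sup>+t\<in>{0<..}. k t \<partial>lborel) = (SUP n. \<integral>\<^sup>+t\<in>I n. k t \<partial>lborel)"
    if [measurable]: "k \<in> borel_measurable borel" for k :: "real \<Rightarrow> ennreal"
  proof -
    have "k t * indicator {0<..} t = (SUP n. k t * indicator (I n) t)" for t
    proof (cases "0 < t")
      case True
      then obtain n where "t \<in> I n" using I_UN by blast
      then show ?thesis
        using True by (intro antisym SUP_least SUP_upper2[of n]) (auto split: split_indicator)
    next
      case False
      then have "t \<notin> I n" for n using I_UN by blast
      then show ?thesis using False by simp
    qed
    then show ?thesis
      using I_inc
      by (subst nn_integral_monotone_convergence_SUP[symmetric])
         (auto simp: incseq_def le_fun_def intro!: mult_left_mono split: split_indicator)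
  qed
  have piece: "(\<integral>\<^sup>+t\<in>I n. h t \<partial>lborel) = (\<integral>\<^sup>+t\<in>I n. h (inverse t) * ennreal (1 / t\<^sup>2) \<partial>lborel)" for n
  proof -
    let ?N = "real n + 2"
    have *: "1 / ?N < ?N" by (simp add: field_simps) (smt (verit) mult_nonneg_nonneg of_nat_0_le_iff)
    have "(\<integral>\<^sup>+t. h t * indicator {-1 / (-?N)..-1 / (-1/?N)} t \<partial>lborel) =
        (\<integral>\<^sup>+t. h (-1 / t) * ennreal (1 / t\<^sup>2) * indicator {-?N..-1/?N} t \<partial>lborel)"
    \<comment> \<open>The map -1/t sends the end points -N and -1/N to 1/N and N, so the left-hand
      integral is over \<open>I n\<close>.\<close>
    proof (rule nn_integral_substitution_aux)
      have neg: "t < 0" if "t \<in> {-?N..-1/?N}" for t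
      proof -
        have "-1/?N < 0" by simp
        with that show ?thesis by (simp only: atLeastAtMost_iff) linarith
      qed
      show "((\<lambda>t. - 1 / t) has_real_derivative 1 / t\<^sup>2) (at t)" if "t \<in> {-?N..-1/?N}" for t
        using neg[OF that] by (auto intro!: derivative_eq_intros simp: power2_eq_square)
      show "continuous_on {-?N..-1/?N} (\<lambda>t. 1 / t\<^sup>2)"
        by (intro continuous_intros) (auto dest: neg)
      show "-?N < -1/?N" using * by simp
    qed auto
    \<comment> \<open>The reflection of t to -t returns to the positive axis.\<close>
    also have "\<dots> = (\<integral>\<^sup>+t. h (-1 / (0 + -1 * t)) * ennreal (1 / (0 + -1 * t)\<^sup>2) * indicator {-?N..-1/?N} (0 + -1 * t) \<partial>lborel)"
      by (subst nn_integral_real_affine[where c = "-1" and t = 0]) auto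
    also have "\<dots> = (\<integral>\<^sup>+t\<in>I n. h (inverse t) * ennreal (1 / t\<^sup>2) \<partial>lborel)"
      by (intro nn_integral_cong) (auto simp: I_def inverse_eq_divide split: split_indicator)
    also have "{-1 / (-?N)..-1 / (-1/?N)} = I n"
      unfolding I_def by (intro arg_cong2[where f = atLeastAtMost]) (simp_all add: field_simps)
    finally show ?thesis .
  qed
  have "(\<integral>\<^sup>+t. f t \<partial>lborel_pos) = (\<integral>\<^sup>+t\<in>{0<..}. h t \<partial>lborel)"
    unfolding nn_integral_lborel_pos h_def by (intro nn_integral_cong) (simp split: split_indicator)
  also have "\<dots> = (\<integral>\<^sup>+t\<in>{0<..}. h (inverse t) * ennreal (1 / t\<^sup>2) \<partial>lborel)"
    by (simp add: exhaust piece)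
  also have "\<dots> = (\<integral>\<^sup>+t. f (inverse t) * ennreal (1 / t\<^sup>2) \<partial>lborel_pos)"
    unfolding nn_integral_lborel_pos h_def by (intro nn_integral_cong) (simp split: split_indicator)
  finally show ?thesis .
qed

text \<open>
  The set is the fundamental domain \<open>S \<setminus> 2S\<close> of the multiplicative subgroup generated by 2; it
  is an interval with end points \<open>u\<close> and \<open>2u\<close>.
\<close>

lemma nn_integral_inverse_dyadic_shell:
  fixes S :: "real set"
  assumes up: "\<And>s t. s \<in> S \<Longrightarrow> s \<le> t \<Longrightarrow> t \<in> S"
    and pos: "a \<in> S" "0 < b" "b \<notin> S"
  shows "(\<integral>\<^sup>+t. indicator {t. t \<in> S \<and> t / 2 \<notin> S} t * ennreal (1 / t) \<partial>lborel_pos) = ennreal (ln 2)"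
proof -
  \<comment> \<open>The ray S starts at u. Since b is a positive lower bound of S, also u > 0, and
    1/t is integrable over [u, 2u].\<close>
  define u where "u = Inf S"
  have lower: "b \<le> s" if "s \<in> S" for s
    using up[OF that, of b] pos by fastforce
  have bdd: "bdd_below S" using lower by (rule bdd_belowI)
  have u: "0 < u" using cInf_greatest[of S b] lower pos unfolding u_def by fastforce
  have below: "t \<notin> S" if "t < u" for t
    using cInf_lower[OF _ bdd, of t] that unfolding u_def by force
  have above: "t \<in> S" if "u < t" for t
    using cInf_lessD[of S t] that pos up unfolding u_def by (metis empty_iff less_imp_le)
  have "(\<integral>\<^sup>+t. indicator {t. t \<in> S \<and> t / 2 \<notin> S} t * ennreal (1 / t) \<partial>lborel_pos) =
      (\<integral>\<^sup>+t\<in>{u..2*u}. ennreal (1 / t) \<partial>lborel)"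
    unfolding nn_integral_lborel_pos
  \<comment> \<open>Whether u lies in S is not determined, so the shell agrees with [u, 2u] only up
    to the points u and 2u.\<close>
  proof (rule nn_integral_cong_AE)
    show "AE t in lborel. indicator {t. t \<in> S \<and> t / 2 \<notin> S} t * ennreal (1 / t) * indicator {0<..} t =
        ennreal (1 / t) * indicator {u..2*u} t"
      using AE_lborel_singleton[of u] AE_lborel_singleton[of "2*u"]
    proof eventually_elim
      case (elim t)
      have "t \<in> S \<longleftrightarrow> u \<le> t" using above[of t] below[of t] elim by force
      moreover have "t / 2 \<in> S \<longleftrightarrow> 2 * u \<le> t" using above[of "t/2"] below[of "t/2"] elim by force
      ultimately show ?case using u elim by (auto split: split_indicator)
    qed
  qed
  also have "\<dots> = ennreal (ln (2*u) - ln u)"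
    using u by (intro nn_integral_FTC_Icc) (auto intro!: derivative_eq_intros simp: divide_inverse)
  also have "ln (2*u) - ln u = ln 2" using u by (simp add: ln_mult)
  finally show ?thesis .
qed

lemma sigma_finite_lborel_pos: "sigma_finite_measure lborel_pos"
  by (intro sigma_finite_measure_restrict_space lborel.sigma_finite_measure_axioms) simp

text \<open>The mass near 0 may be infinite, but the density is real-valued; sigma-finiteness makes
  the product with \<pi> accessible to Fubini.\<close>

lemma sigma_finite_theta: "sigma_finite_measure (theta \<alpha>)"
proof -
  interpret sigma_finite_measure lborel_pos by (rule sigma_finite_lborel_pos)
  have "(\<lambda>t. ennreal (\<alpha> * t powr (-(\<alpha> + 1)))) \<in> borel_measurable lborel_pos"
    by (intro measurable_restrict_space1) simp
  then show ?thesis unfolding theta_def by (subst sigma_finite_iff_density_finite) auto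
qed

section \<open>Scaled sets, the push-forward and the dilation of the integral\<close>

context scaling
begin

lemma scaling_in_space: "0 < t \<Longrightarrow> x \<in> space M \<Longrightarrow> sc t x \<in> space M"
  using measurable_space[OF measurable_scaling_fixed] .

text \<open>On \<open>space M\<close> the map \<open>sc (inverse t)\<close> inverts
  \<open>sc t\<close>, so the image is a preimage; this form suits both simplification and
  measurability.\<close>

lemma mem_scaled_set_iff:
  assumes "B \<subseteq> space M" "0 < t"
  shows "x \<in> sc t ` B \<longleftrightarrow> x \<in> space M \<and> sc (inverse t) x \<in> B"
proof
  assume "x \<in> sc t ` B"
  then obtain y where "y \<in> B" "x = sc t y" by blast
  then show "x \<in> space M \<and> sc (inverse t) x \<in> B"
    using assms by (auto simp: scaling_in_space scaling_scaling scaling_one)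
next
  assume *: "x \<in> space M \<and> sc (inverse t) x \<in> B"
  then have "x = sc t (sc (inverse t) x)"
    using assms by (simp add: scaling_scaling scaling_one)
  then show "x \<in> sc t ` B" using * by blast
qed

lemma scaled_scaled_set:
  assumes "B \<subseteq> space M" "0 < s" "0 < t"
  shows "sc t ` sc s ` B = sc (t * s) ` B"
  unfolding image_image using assms by (intro image_cong) (auto simp: scaling_scaling)

lemma measurable_action: "(\<lambda>(x, t). sc t x) \<in> M \<Otimes>\<^sub>M lborel_pos \<rightarrow>\<^sub>M M"
  using measurable_scaling
  by (subst measurable_cong_sets[OF sets_pair_measure_cong[OF refl sets_restrict_space_cong[OF sets_lborel]] refl])

lemma measurable_inverse_action: "(\<lambda>(x, t). sc (inverse t) x) \<in> M \<Otimes>\<^sub>M lborel_pos \<rightarrow>\<^sub>M M"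
proof -
  have "inverse \<in> lborel_pos \<rightarrow>\<^sub>M lborel_pos"
    by (intro measurable_restrict_space3) auto
  then have "(\<lambda>z. (fst z, inverse (snd z))) \<in> M \<Otimes>\<^sub>M lborel_pos \<rightarrow>\<^sub>M M \<Otimes>\<^sub>M lborel_pos"
    by measurable
  from measurable_compose[OF this measurable_action] show ?thesis
    by (simp add: case_prod_unfold)
qed

text \<open>The value is the integral over x of the indicator of B at x/t, which is jointly
  measurable in t and x, so Tonelli applies.\<close>

lemma measurable_emeasure_scaled_set:
  assumes "sigma_finite_measure \<mu>" and sets: "sets \<mu> = sets M" and B: "B \<in> sets M"
  shows "(\<lambda>t. emeasure \<mu> (sc t ` B)) \<in> borel_measurable lborel_pos"
proof -
  interpret sigma_finite_measure \<mu> by fact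
  have *: "(\<lambda>(t, x). indicator B (sc (inverse t) x) :: ennreal) \<in> borel_measurable (lborel_pos \<Otimes>\<^sub>M \<mu>)"
  proof -
    have "(\<lambda>(t, x). (x, t)) \<in> lborel_pos \<Otimes>\<^sub>M \<mu> \<rightarrow>\<^sub>M M \<Otimes>\<^sub>M lborel_pos"
      by (simp add: sets cong: measurable_cong_sets sets_pair_measure_cong)
    from measurable_compose[OF this measurable_inverse_action]
    have "(\<lambda>(t, x). sc (inverse t) x) \<in> lborel_pos \<Otimes>\<^sub>M \<mu> \<rightarrow>\<^sub>M M"
      by (simp add: case_prod_unfold)
    from measurable_compose[OF this borel_measurable_indicator[OF B]] show ?thesis
      by (simp add: case_prod_unfold)
  qed
  have "emeasure \<mu> (sc t ` B) = (\<integral>\<^sup>+x. indicator B (sc (inverse t) x) \<partial>\<mu>)" if "t \<in> space lborel_pos" for t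
  proof -
    have t: "0 < t" using that by (simp add: space_restrict_space)
    have "emeasure \<mu> (sc t ` B) = (\<integral>\<^sup>+x. indicator (sc t ` B) x \<partial>\<mu>)"
      using scaled_set_in_sets[OF t B] sets by simp
    also have "\<dots> = (\<integral>\<^sup>+x. indicator B (sc (inverse t) x) \<partial>\<mu>)"
      using mem_scaled_set_iff[OF sets.sets_into_space[OF B] t] sets_eq_imp_space_eq[OF sets]
      by (intro nn_integral_cong) (auto split: split_indicator)
    finally show ?thesis .
  qed
  then show ?thesis
    using borel_measurable_nn_integral[OF *] by (subst measurable_cong) auto
qed

lemma measurable_emeasure_scaled_set_powr:
  assumes "sigma_finite_measure \<mu>" "sets \<mu> = sets M" "B \<in> sets M"
  shows "(\<lambda>t. emeasure \<mu> (sc t ` B) * ennreal (t powr a)) \<in> borel_measurable lborel_pos"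
  by (intro borel_measurable_times_ennreal measurable_emeasure_scaled_set[OF assms] measurable_restrict_space1) simp

text \<open>By Fubini, the section at t of the preimage of B is B scaled by 1/t. Inverting t then
  turns the density of \<open>theta \<alpha>\<close> into \<alpha> t^(\<alpha>-1), which links (ii)
  to (iii).\<close>

lemma emeasure_distr_action:
  assumes "sigma_finite_measure \<pi>" and sets: "sets \<pi> = sets M" and B: "B \<in> sets M" and \<alpha>: "0 < \<alpha>"
  shows "emeasure (distr (\<pi> \<Otimes>\<^sub>M theta \<alpha>) M (\<lambda>(x, t). sc t x)) B =
    ennreal \<alpha> * (\<integral>\<^sup>+t. emeasure \<pi> (sc t ` B) * ennreal (t powr (\<alpha> - 1)) \<partial>lborel_pos)"
proof -
  interpret pair_sigma_finite \<pi> "theta \<alpha>"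
    using assms(1) sigma_finite_theta by (simp add: pair_sigma_finite_def)
  note space = sets_eq_imp_space_eq[OF sets]
  have space_theta: "space (theta \<alpha>) = {0<..}"
    by (simp add: theta_def space_restrict_space)
  have act: "(\<lambda>(x, t). sc t x) \<in> \<pi> \<Otimes>\<^sub>M theta \<alpha> \<rightarrow>\<^sub>M M"
    using measurable_action unfolding theta_def
    by (simp add: sets cong: measurable_cong_sets sets_pair_measure_cong)
  define F where "F t = emeasure \<pi> (sc t ` B)" for t
  have F: "F \<in> borel_measurable lborel_pos"
    unfolding F_def by (rule measurable_emeasure_scaled_set[OF assms(1-3)])
  have F': "(\<lambda>t. F (inverse t)) \<in> borel_measurable lborel_pos"
    by (rule measurable_compose[OF _ F]) (intro measurable_restrict_space3, auto)
  have pow: "(\<lambda>t. ennreal (f t)) \<in> borel_measurable lborel_pos"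
    if "f \<in> borel_measurable borel" for f :: "real \<Rightarrow> real"
    using that by (intro measurable_restrict_space1) simp
  have "emeasure (distr (\<pi> \<Otimes>\<^sub>M theta \<alpha>) M (\<lambda>(x, t). sc t x)) B =
      (\<integral>\<^sup>+t. emeasure \<pi> ((\<lambda>x. (x, t)) -` ((\<lambda>(x, t). sc t x) -` B \<inter> space (\<pi> \<Otimes>\<^sub>M theta \<alpha>))) \<partial>theta \<alpha>)"
    using act B by (simp add: emeasure_distr emeasure_pair_measure_alt2)
  also have "\<dots> = (\<integral>\<^sup>+t. F (inverse t) \<partial>theta \<alpha>)"
  proof (intro nn_integral_cong)
    fix t assume "t \<in> space (theta \<alpha>)"
    then have t: "0 < t" by (simp add: space_theta)
    then have "(\<lambda>x. (x, t)) -` ((\<lambda>(x, t). sc t x) -` B \<inter> space (\<pi> \<Otimes>\<^sub>M theta \<alpha>)) = sc (inverse t) ` B"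
      using mem_scaled_set_iff[OF sets.sets_into_space[OF B], of "inverse t"]
      by (intro set_eqI) (simp add: space_pair_measure space_theta space conj_commute)
    then show "emeasure \<pi> ((\<lambda>x. (x, t)) -` ((\<lambda>(x, t). sc t x) -` B \<inter> space (\<pi> \<Otimes>\<^sub>M theta \<alpha>))) = F (inverse t)"
      by (simp add: F_def)
  qed
  also have "\<dots> = (\<integral>\<^sup>+t. ennreal (\<alpha> * t powr (-(\<alpha> + 1))) * F (inverse t) \<partial>lborel_pos)"
    unfolding theta_def by (rule nn_integral_density[OF pow F']) simp
  also have "\<dots> = (\<integral>\<^sup>+t. ennreal \<alpha> * (F (inverse t) * ennreal (inverse t powr (\<alpha> - 1)) * ennreal (1 / t\<^sup>2)) \<partial>lborel_pos)"
  proof (intro nn_integral_cong)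
    fix t assume "t \<in> space lborel_pos"
    then have t: "0 < t" by (simp add: space_restrict_space)
    \<comment> \<open>The factor t^(-2) is split off as the Jacobian of the inversion; the rest is
      the power \<alpha> - 1 of 1/t.\<close>
    have "t powr (-(\<alpha> + 1)) = t powr (- (\<alpha> - 1)) * t powr (-2)"
      by (subst powr_add[symmetric]) (simp add: algebra_simps)
    also have "t powr (- (\<alpha> - 1)) = inverse t powr (\<alpha> - 1)"
      using t by (simp only: powr_minus inverse_powr)
    also have "t powr (-2) = 1 / t\<^sup>2"
      using t by (simp add: powr_minus powr_numeral inverse_eq_divide)
    finally have *: "t powr (-(\<alpha> + 1)) = inverse t powr (\<alpha> - 1) * (1 / t\<^sup>2)" .
    have scalars: "ennreal (\<alpha> * (p * q)) * F (inverse t) = ennreal \<alpha> * (F (inverse t) * ennreal p * ennreal q)"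
      if "0 \<le> p" "0 \<le> q" for p q
      using that \<alpha> by (simp add: ennreal_mult mult_ac)
    show "ennreal (\<alpha> * t powr (-(\<alpha> + 1))) * F (inverse t) =
        ennreal \<alpha> * (F (inverse t) * ennreal (inverse t powr (\<alpha> - 1)) * ennreal (1 / t\<^sup>2))"
      unfolding * by (rule scalars) simp_all
  qed
  also have "\<dots> = ennreal \<alpha> * (\<integral>\<^sup>+t. F (inverse t) * ennreal (inverse t powr (\<alpha> - 1)) * ennreal (1 / t\<^sup>2) \<partial>lborel_pos)"
    by (intro nn_integral_cmult borel_measurable_times_ennreal F' pow) simp_all
  also have "(\<integral>\<^sup>+t. F (inverse t) * ennreal (inverse t powr (\<alpha> - 1)) * ennreal (1 / t\<^sup>2) \<partial>lborel_pos) =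
      (\<integral>\<^sup>+t. F t * ennreal (t powr (\<alpha> - 1)) \<partial>lborel_pos)"
    by (intro nn_integral_lborel_pos_inverse[symmetric] borel_measurable_times_ennreal F pow) simp
  finally show ?thesis by (simp add: F_def)
qed

text \<open>Scaling by s and then t is scaling by st. Substituting st for t, the power contributes
  s^(1-\<alpha>) and the dilation of Lebesgue measure contributes 1/s.\<close>

lemma nn_integral_scaled_scaled_set:
  assumes "sigma_finite_measure \<pi>" "sets \<pi> = sets M" and B: "B \<in> sets M" and s: "0 < s"
  shows "(\<integral>\<^sup>+t. emeasure \<pi> (sc t ` sc s ` B) * ennreal (t powr (\<alpha> - 1)) \<partial>lborel_pos) =
    ennreal (s powr (-\<alpha>)) * (\<integral>\<^sup>+t. emeasure \<pi> (sc t ` B) * ennreal (t powr (\<alpha> - 1)) \<partial>lborel_pos)"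
proof -
  define G where "G t = emeasure \<pi> (sc t ` B) * ennreal (t powr (\<alpha> - 1))" for t
  have G: "G \<in> borel_measurable lborel_pos"
    unfolding G_def by (rule measurable_emeasure_scaled_set_powr[OF assms(1-3)])
  have Gs: "(\<lambda>t. G (s * t)) \<in> borel_measurable lborel_pos"
    by (rule measurable_compose[OF _ G]) (intro measurable_restrict_space3, auto simp: s)
  have "(\<integral>\<^sup>+t. emeasure \<pi> (sc t ` sc s ` B) * ennreal (t powr (\<alpha> - 1)) \<partial>lborel_pos) =
      (\<integral>\<^sup>+t. ennreal (s powr (1 - \<alpha>)) * G (s * t) \<partial>lborel_pos)"
  proof (intro nn_integral_cong)
    fix t assume "t \<in> space lborel_pos"
    then have t: "0 < t" by (simp add: space_restrict_space)
    have "t powr (\<alpha> - 1) = s powr (1 - \<alpha>) * (s * t) powr (\<alpha> - 1)"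
      using s t by (simp add: powr_mult mult.assoc[symmetric] powr_add[symmetric])
    then show "emeasure \<pi> (sc t ` sc s ` B) * ennreal (t powr (\<alpha> - 1)) =
        ennreal (s powr (1 - \<alpha>)) * G (s * t)"
      using scaled_scaled_set[OF sets.sets_into_space[OF B] s t]
      by (simp add: G_def ennreal_mult mult_ac)
  qed
  also have "\<dots> = ennreal (s powr (1 - \<alpha>)) * (\<integral>\<^sup>+t. G (s * t) \<partial>lborel_pos)"
    by (rule nn_integral_cmult[OF Gs])
  also have "\<dots> = ennreal (s powr (-\<alpha>)) * (ennreal s * (\<integral>\<^sup>+t. G (s * t) \<partial>lborel_pos))"
    using s by (simp add: mult.assoc[symmetric] ennreal_mult[symmetric] powr_mult_base mult.commute)
  also have "ennreal s * (\<integral>\<^sup>+t. G (s * t) \<partial>lborel_pos) = (\<integral>\<^sup>+t. G t \<partial>lborel_pos)"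
    by (rule nn_integral_lborel_pos_scale[OF G s, symmetric])
  finally show ?thesis unfolding G_def .
qed

end

section \<open>Shells of a homogeneous measure and the spectral measure\<close>

text \<open>The setting of (i) with the family \<open>U k\<close> merged into one set. The times at
  which an orbit is in V form a nonempty upward closed set. A locale permits a second instance at a
  multiple of V.\<close>

locale homogeneous_base = scaling M sc
  for M :: "'a measure" and sc +
  fixes \<nu> :: "'a measure" and \<alpha> :: real and V :: "'a set"
  assumes sets: "sets \<nu> = sets M"
    and homogeneous: "homogeneous sc \<alpha> \<nu>"
    and exponent_pos: "0 < \<alpha>"
    and base_in_sets: "V \<in> sets M"
    and base_upward: "\<And>x t. x \<in> V \<Longrightarrow> 1 \<le> t \<Longrightarrow> sc t x \<in> V"
    and base_absorbs: "\<And>x. x \<in> space M \<Longrightarrow> \<exists>t>0. sc t x \<in> V"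
    and base_finite: "emeasure \<nu> V < \<infinity>"
begin

lemma space_nu: "space \<nu> = space M"
  by (rule sets_eq_imp_space_eq[OF sets])

lemma base_subset: "V \<subseteq> space M"
  by (rule sets.sets_into_space[OF base_in_sets])

lemma emeasure_scaled_set:
  "B \<in> sets M \<Longrightarrow> 0 < s \<Longrightarrow> emeasure \<nu> (sc s ` B) = ennreal (s powr (-\<alpha>)) * emeasure \<nu> B"
  using homogeneous unfolding homogeneous_def sets by blast

text \<open>Upward closure along the orbit of a point that need not itself lie in V.\<close>

lemma base_upward_le:
  assumes "x \<in> space M" "sc s x \<in> V" "0 < s" "s \<le> t"
  shows "sc t x \<in> V"
proof -
  have "sc (t / s) (sc s x) = sc t x" using assms by (subst scaling_scaling) auto
  then show ?thesis using base_upward[of "sc s x" "t / s"] assms by simp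
qed

text \<open>The multiples of V by 1/(n+1) have finite measure by homogeneity. They cover the space,
  since a point that reaches V at a time t < n is in V at time n+1.\<close>

lemma sigma_finite: "sigma_finite_measure \<nu>"
proof
  define A where "A = range (\<lambda>n. sc (inverse (real (Suc n))) ` V)"
  have "space M \<subseteq> \<Union>A"
  proof
    fix x assume x: "x \<in> space M"
    then obtain t where t: "0 < t" "sc t x \<in> V" using base_absorbs by blast
    obtain n where "t < real n" using reals_Archimedean2 by blast
    then have "sc (real (Suc n)) x \<in> V" using base_upward_le[OF x t(2) t(1)] by simp
    then have "x \<in> sc (inverse (real (Suc n))) ` V"
      using x by (subst mem_scaled_set_iff[OF base_subset]) auto
    then show "x \<in> \<Union>A" by (auto simp: A_def)
  qed
  moreover have A: "A \<subseteq> sets M" unfolding A_def by (auto intro!: scaled_set_in_sets base_in_sets)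
  then have "\<Union>A \<subseteq> space M" using sets.sets_into_space by blast
  ultimately have "\<Union>A = space M" by (rule antisym[rotated])
  moreover have "emeasure \<nu> a \<noteq> \<infinity>" if "a \<in> A" for a
    using that base_finite unfolding A_def
    by (auto simp: emeasure_scaled_set[OF base_in_sets] ennreal_mult_eq_top_iff)
  moreover have "countable A" unfolding A_def by simp
  ultimately show "\<exists>A. countable A \<and> A \<subseteq> sets \<nu> \<and> \<Union>A = space \<nu> \<and> (\<forall>a\<in>A. emeasure \<nu> a \<noteq> \<infinity>)"
    unfolding sets space_nu using A by blast
qed

text \<open>The exceptional set is scaling-invariant and of finite measure, hence null by homogeneity.\<close>

lemma AE_leaves_base: "AE x in \<nu>. \<exists>t>0. sc t x \<notin> V"
proof (rule AE_I')
  \<comment> \<open>As a countable intersection E is measurable, and it contains every point whose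
    orbit stays in V. Its measure is at most (n+1)^(-\<alpha>) \<nu>(V) for every n.\<close>
  define E where "E = (\<Inter>n. sc (real (Suc n)) ` V)"
  have E: "E \<in> sets M" unfolding E_def by (intro sets.countable_INT) (auto intro!: scaled_set_in_sets base_in_sets)
  obtain c where c: "0 \<le> c" "emeasure \<nu> V = ennreal c"
    using base_finite by (cases "emeasure \<nu> V") auto
  have "emeasure \<nu> E \<le> ennreal (real (Suc n) powr (-\<alpha>) * c)" for n
  proof -
    have "emeasure \<nu> E \<le> emeasure \<nu> (sc (real (Suc n)) ` V)"
      unfolding E_def by (intro emeasure_mono) (auto simp: sets intro!: scaled_set_in_sets base_in_sets)
    also have "\<dots> = ennreal (real (Suc n) powr (-\<alpha>) * c)"
      using c by (subst emeasure_scaled_set[OF base_in_sets]) (auto simp: ennreal_mult)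
    finally show ?thesis .
  qed
  moreover have "(\<lambda>n. ennreal (real (Suc n) powr (-\<alpha>) * c)) \<longlonglongrightarrow> ennreal (0 * c)"
    using exponent_pos
    by (intro tendsto_ennrealI tendsto_mult_right tendsto_neg_powr filterlim_compose[OF filterlim_real_sequentially filterlim_Suc]) auto
  ultimately have "emeasure \<nu> E \<le> ennreal (0 * c)"
    by (intro LIMSEQ_le_const) auto
  then show "E \<in> null_sets \<nu>" using E sets by auto
  show "{x \<in> space \<nu>. \<not> (\<exists>t>0. sc t x \<notin> V)} \<subseteq> E"
  proof
    fix x assume x: "x \<in> {x \<in> space \<nu>. \<not> (\<exists>t>0. sc t x \<notin> V)}"
    then show "x \<in> E"
      unfolding E_def by (auto simp: mem_scaled_set_iff[OF base_subset] space_nu simp del: of_nat_Suc)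
  qed
qed

text \<open>
  By homogeneity \<open>\<nu>(A \<inter> tB) = t\<^sup>-\<^sup>\<alpha> \<nu>(t\<^sup>-\<^sup>1A \<inter> B)\<close>, so after exchanging the integrals it
  remains to see that almost every orbit \<open>{ty : t > 0}\<close> spends the multiplicative length \<open>ln 2\<close>
  in \<open>A = V \<setminus> 2V\<close>.
\<close>

lemma nn_integral_emeasure_shell:
  assumes B: "B \<in> sets M"
  shows "(\<integral>\<^sup>+t. emeasure \<nu> ((V - sc 2 ` V) \<inter> sc t ` B) * ennreal (t powr (\<alpha> - 1)) \<partial>lborel_pos) =
    ennreal (ln 2) * emeasure \<nu> B"
proof -
  interpret pair_sigma_finite \<nu> lborel_pos
    using sigma_finite sigma_finite_lborel_pos by (simp add: pair_sigma_finite_def)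
  define A where "A = V - sc 2 ` V"
  have A: "A \<in> sets M" unfolding A_def by (intro sets.Diff scaled_set_in_sets base_in_sets) simp
  define f :: "'a \<Rightarrow> real \<Rightarrow> ennreal"
    where "f y t = indicator A (sc t y) * ennreal (1 / t) * indicator B y" for y t
  have "case_prod f \<in> borel_measurable (M \<Otimes>\<^sub>M lborel_pos)"
  proof -
    have *: "(\<lambda>z. indicator A (case z of (y, t) \<Rightarrow> sc t y) :: ennreal) \<in> borel_measurable (M \<Otimes>\<^sub>M lborel_pos)"
      by (rule measurable_compose[OF measurable_action borel_measurable_indicator[OF A]])
    have "(\<lambda>t. ennreal (1 / t)) \<in> borel_measurable lborel_pos"
      by (intro measurable_restrict_space1) simp
    then have "(\<lambda>z. ennreal (1 / snd z)) \<in> borel_measurable (M \<Otimes>\<^sub>M lborel_pos)"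
      by measurable
    moreover have "(\<lambda>z. indicator B (fst z) :: ennreal) \<in> borel_measurable (M \<Otimes>\<^sub>M lborel_pos)"
      using B by measurable
    ultimately show ?thesis
      using * by (simp add: f_def case_prod_unfold borel_measurable_times_ennreal)
  qed
  then have f: "case_prod f \<in> borel_measurable (\<nu> \<Otimes>\<^sub>M lborel_pos)"
    by (simp add: sets cong: measurable_cong_sets sets_pair_measure_cong)
  have "emeasure \<nu> (A \<inter> sc t ` B) * ennreal (t powr (\<alpha> - 1)) = (\<integral>\<^sup>+y. f y t \<partial>\<nu>)" if t: "0 < t" for t
  proof -
    let ?C = "sc (inverse t) ` A \<inter> B"
    have C: "?C \<in> sets M" using A B t by (intro sets.Int scaled_set_in_sets) auto
    note mem = mem_scaled_set_iff[OF sets.sets_into_space[OF A]] mem_scaled_set_iff[OF sets.sets_into_space[OF B]]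
      mem_scaled_set_iff[OF sets.sets_into_space[OF C]]
    have "x \<in> A \<inter> sc t ` B \<longleftrightarrow> x \<in> sc t ` ?C" for x
    proof (cases "x \<in> space M")
      case True
      then show ?thesis
        using t by (simp add: mem scaling_scaling scaling_one scaling_in_space)
    next
      case False
      then show ?thesis using t by (simp add: mem)
    qed
    then have "A \<inter> sc t ` B = sc t ` ?C" by blast
    then have "emeasure \<nu> (A \<inter> sc t ` B) * ennreal (t powr (\<alpha> - 1)) =
        ennreal (t powr (-\<alpha>) * t powr (\<alpha> - 1)) * emeasure \<nu> ?C"
      using emeasure_scaled_set[OF C t] by (simp add: ennreal_mult mult_ac)
    \<comment> \<open>The exponent \<alpha> cancels, leaving the density 1/t of Haar measure on the
      multiplicative group.\<close>
    also have "t powr (-\<alpha>) * t powr (\<alpha> - 1) = t powr (-1)"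
      by (simp add: powr_add[symmetric])
    also have "t powr (-1) = 1 / t"
      using t by (simp add: powr_minus inverse_eq_divide)
    also have "ennreal (1 / t) * emeasure \<nu> ?C = (\<integral>\<^sup>+y. ennreal (1 / t) * indicator ?C y \<partial>\<nu>)"
      using C sets by (intro nn_integral_cmult_indicator[symmetric]) simp
    also have "\<dots> = (\<integral>\<^sup>+y. f y t \<partial>\<nu>)"
      using t mem_scaled_set_iff[OF sets.sets_into_space[OF A], of "inverse t"]
      by (intro nn_integral_cong) (simp add: f_def indicator_def space_nu)
    finally show ?thesis .
  qed
  then have "(\<integral>\<^sup>+t. emeasure \<nu> (A \<inter> sc t ` B) * ennreal (t powr (\<alpha> - 1)) \<partial>lborel_pos) =
      (\<integral>\<^sup>+t. \<integral>\<^sup>+y. f y t \<partial>\<nu> \<partial>lborel_pos)"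
    by (intro nn_integral_cong) (simp add: space_restrict_space)
  also have "\<dots> = (\<integral>\<^sup>+y. \<integral>\<^sup>+t. f y t \<partial>lborel_pos \<partial>\<nu>)"
    by (rule Fubini'[OF f])
  also have "\<dots> = (\<integral>\<^sup>+y. ennreal (ln 2) * indicator B y \<partial>\<nu>)"
  proof (rule nn_integral_cong_AE)
    show "AE y in \<nu>. (\<integral>\<^sup>+t. f y t \<partial>lborel_pos) = ennreal (ln 2) * indicator B y"
      using AE_leaves_base AE_space
    proof eventually_elim
      case (elim y)
      then have y: "y \<in> space M" by (simp add: space_nu)
      obtain a b where ab: "0 < a" "sc a y \<in> V" "0 < b" "sc b y \<notin> V"
        using base_absorbs[OF y] elim by blast
      \<comment> \<open>The point ty is in 2V exactly when (t/2)y is in V, so the visits to A form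
        the dyadic shell of S. Absorption provides a in S, and \<open>AE_leaves_base\<close>
        provides b outside S.\<close>
      define S where "S = {t. 0 < t \<and> sc t y \<in> V}"
      have "sc t y \<in> A \<longleftrightarrow> t \<in> {t. t \<in> S \<and> t / 2 \<notin> S}" if t: "0 < t" for t
        using t y by (simp add: A_def S_def mem_scaled_set_iff[OF base_subset] scaling_in_space scaling_scaling field_simps)
      then have "(\<integral>\<^sup>+t. f y t \<partial>lborel_pos) =
          (\<integral>\<^sup>+t. indicator {t. t \<in> S \<and> t / 2 \<notin> S} t * ennreal (1 / t) * indicator B y \<partial>lborel_pos)"
        unfolding f_def by (intro nn_integral_cong) (simp add: indicator_def space_restrict_space)
      also have "\<dots> = (\<integral>\<^sup>+t. indicator {t. t \<in> S \<and> t / 2 \<notin> S} t * ennreal (1 / t) \<partial>lborel_pos) * indicator B y"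
        by (simp split: split_indicator)
      also have "(\<integral>\<^sup>+t. indicator {t. t \<in> S \<and> t / 2 \<notin> S} t * ennreal (1 / t) \<partial>lborel_pos) = ennreal (ln 2)"
        using ab base_upward_le[OF y]
        by (intro nn_integral_inverse_dyadic_shell[of S a b]) (force simp: S_def)+
      finally show ?case .
    qed
  qed
  also have "\<dots> = ennreal (ln 2) * emeasure \<nu> B"
    using B sets by (simp add: nn_integral_cmult)
  finally show ?thesis unfolding A_def .
qed

text \<open>\<open>sc s\<close> commutes with every \<open>sc t\<close>, and homogeneity keeps the
  measure finite. The free factor s later normalises the mass of the shell.\<close>

lemma homogeneous_base_scaled:
  assumes s: "0 < s"
  shows "homogeneous_base M sc \<nu> \<alpha> (sc s ` V)"
proof unfold_locales
  note mem = mem_scaled_set_iff[OF base_subset s]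
  show "sc s ` V \<in> sets M" by (rule scaled_set_in_sets[OF s base_in_sets])
  show "sc t x \<in> sc s ` V" if "x \<in> sc s ` V" "1 \<le> t" for x t
    using that s base_upward[of "sc (inverse s) x" t]
    by (simp add: mem scaling_in_space scaling_scaling mult.commute)
  show "\<exists>t>0. sc t x \<in> sc s ` V" if x: "x \<in> space M" for x
  proof -
    obtain t where t: "0 < t" "sc t x \<in> V" using base_absorbs[OF x] by blast
    then have "sc (s * t) x \<in> sc s ` V" using x s by (simp add: scaling_scaling[symmetric])
    then show ?thesis using s t by (intro exI[of _ "s * t"]) simp
  qed
  show "emeasure \<nu> (sc s ` V) < \<infinity>"
    using base_finite by (simp add: emeasure_scaled_set[OF base_in_sets s] ennreal_mult_less_top)
qed (fact sets homogeneous exponent_pos)+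

text \<open>The measure \<pi> is \<nu> on the shell of sV, divided by \<alpha> ln 2. The shell
  integral contributes ln 2, which cancels together with \<alpha>.\<close>

lemma exists_spectral_measure:
  assumes nonzero: "emeasure \<nu> (space M) \<noteq> 0"
  shows "\<exists>\<pi>. prob_space \<pi> \<and> sets \<pi> = sets M \<and>
    (\<forall>B\<in>sets M. emeasure \<nu> B =
      ennreal \<alpha> * (\<integral>\<^sup>+t. emeasure \<pi> (sc t ` B) * ennreal (t powr (\<alpha> - 1)) \<partial>lborel_pos))"
proof -
  define A where "A = V - sc 2 ` V"
  have A: "A \<in> sets M" unfolding A_def by (intro sets.Diff scaled_set_in_sets base_in_sets) simp
  have "emeasure \<nu> A \<le> emeasure \<nu> V"
    unfolding A_def using base_in_sets sets by (intro emeasure_mono) auto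
  then obtain c where c: "0 \<le> c" "emeasure \<nu> A = ennreal c"
    using base_finite by (cases "emeasure \<nu> A") (auto simp: top_unique)
  have "c \<noteq> 0" \<comment> \<open>the multiples of the shell carry \<open>\<nu>\<close>\<close>
  proof
    assume "c = 0"
    then have "emeasure \<nu> (A \<inter> C) = 0" for C
      using c emeasure_mono[of "A \<inter> C" A \<nu>] A sets by simp
    then show False
      using nn_integral_emeasure_shell[OF sets.top] nonzero by (simp add: A_def[symmetric])
  qed
  then have "0 < c" using c by simp
  \<comment> \<open>Chosen to solve s^(-\<alpha>) c = \<alpha> ln 2, so that the shell of sV, which
    is sA, has measure \<alpha> ln 2.\<close>
  define s where "s = (c / (\<alpha> * ln 2)) powr (1 / \<alpha>)"
  have s: "0 < s" using \<open>0 < c\<close> exponent_pos by (simp add: s_def)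
  have s_powr: "s powr (-\<alpha>) = \<alpha> * ln 2 / c"
    using \<open>0 < c\<close> exponent_pos by (simp add: s_def powr_powr powr_minus)
  interpret scaled: homogeneous_base M sc \<nu> \<alpha> "sc s ` V" by (rule homogeneous_base_scaled[OF s])
  define D where "D = sc s ` V - sc 2 ` sc s ` V"
  have "sc s ` A = D"
  proof (intro set_eqI)
    fix x
    note mem = mem_scaled_set_iff[OF base_subset] mem_scaled_set_iff[OF scaled.base_subset]
    show "x \<in> sc s ` A \<longleftrightarrow> x \<in> D"
      unfolding mem_scaled_set_iff[OF sets.sets_into_space[OF A] s]
      unfolding A_def D_def using s
      by (cases "x \<in> space M") (simp_all add: mem scaling_in_space scaling_scaling mult.commute)
  qed
  then have D: "D \<in> sets M" and "emeasure \<nu> D = ennreal (s powr (-\<alpha>)) * ennreal c"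
    using emeasure_scaled_set[OF A s] scaled_set_in_sets[OF s A] c by auto
  then have emeasure_D: "emeasure \<nu> D = ennreal (\<alpha> * ln 2)"
    using \<open>0 < c\<close> exponent_pos by (simp add: s_powr ennreal_mult[symmetric])
  \<comment> \<open>An indicator density restricts \<nu> to D while keeping all of
    \<open>space M\<close> as the underlying space.\<close>
  define \<pi> where "\<pi> = scale_measure (ennreal (1 / (\<alpha> * ln 2))) (density \<nu> (indicator D))"
  have sets_\<pi>: "sets \<pi> = sets M" by (simp add: \<pi>_def sets)
  have emeasure_\<pi>: "emeasure \<pi> B = ennreal (1 / (\<alpha> * ln 2)) * emeasure \<nu> (D \<inter> B)" if "B \<in> sets M" for B
    using that D sets by (simp add: \<pi>_def emeasure_restricted)
  have "prob_space \<pi>"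
  proof
    have "emeasure \<pi> (space \<pi>) = ennreal (1 / (\<alpha> * ln 2)) * emeasure \<nu> D"
      using emeasure_\<pi>[OF sets.top] sets.sets_into_space[OF D] sets_eq_imp_space_eq[OF sets_\<pi>]
      by (simp add: Int_absorb2)
    then show "emeasure \<pi> (space \<pi>) = 1"
      using exponent_pos by (simp add: emeasure_D ennreal_mult[symmetric])
  qed
  moreover have "emeasure \<nu> B =
      ennreal \<alpha> * (\<integral>\<^sup>+t. emeasure \<pi> (sc t ` B) * ennreal (t powr (\<alpha> - 1)) \<partial>lborel_pos)"
    if B: "B \<in> sets M" for B
  proof -
    interpret \<pi>: prob_space \<pi> by fact
    \<comment> \<open>Writing \<alpha> as (1 / ln 2) (\<alpha> ln 2) lets the second factor cancel
      the normalisation of \<pi> under the integral.\<close>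
    have "ennreal \<alpha> * (\<integral>\<^sup>+t. emeasure \<pi> (sc t ` B) * ennreal (t powr (\<alpha> - 1)) \<partial>lborel_pos) =
        ennreal (1 / ln 2) * (\<integral>\<^sup>+t. ennreal (\<alpha> * ln 2) * (emeasure \<pi> (sc t ` B) * ennreal (t powr (\<alpha> - 1))) \<partial>lborel_pos)"
      unfolding nn_integral_cmult[OF measurable_emeasure_scaled_set_powr[OF \<pi>.sigma_finite_measure_axioms sets_\<pi> B]]
      using exponent_pos by (simp add: mult.assoc[symmetric] ennreal_mult[symmetric])
    also have "(\<integral>\<^sup>+t. ennreal (\<alpha> * ln 2) * (emeasure \<pi> (sc t ` B) * ennreal (t powr (\<alpha> - 1))) \<partial>lborel_pos) =
        (\<integral>\<^sup>+t. emeasure \<nu> (D \<inter> sc t ` B) * ennreal (t powr (\<alpha> - 1)) \<partial>lborel_pos)"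
    proof (intro nn_integral_cong)
      fix t assume "t \<in> space lborel_pos"
      then have "sc t ` B \<in> sets M" using scaled_set_in_sets[OF _ B] by (simp add: space_restrict_space)
      then show "ennreal (\<alpha> * ln 2) * (emeasure \<pi> (sc t ` B) * ennreal (t powr (\<alpha> - 1))) =
          emeasure \<nu> (D \<inter> sc t ` B) * ennreal (t powr (\<alpha> - 1))"
        using exponent_pos by (simp add: emeasure_\<pi> mult.assoc[symmetric] ennreal_mult[symmetric])
    qed
    also have "\<dots> = ennreal (ln 2) * emeasure \<nu> B"
      unfolding D_def by (rule scaled.nn_integral_emeasure_shell[OF B])
    also have "ennreal (1 / ln 2) * (ennreal (ln 2) * emeasure \<nu> B) = emeasure \<nu> B"
      by (simp add: mult.assoc[symmetric] ennreal_mult[symmetric])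
    finally show ?thesis by simp
  qed
  ultimately show ?thesis using sets_\<pi> by blast
qed

end

section \<open>The converse direction and the merging of the sets \<open>U k\<close>\<close>

text \<open>Homogeneity is the dilation rule for the integral. For nontriviality,
  \<open>space M\<close> is invariant under scaling, so its integrand is t^(\<alpha>-1); were the
  integral zero, the interval (0,1) would be null.\<close>

lemma (in scaling) homogeneous_of_spectral_measure:
  assumes "prob_space \<pi>" and sets_\<pi>: "sets \<pi> = sets M" and sets_\<nu>: "sets \<nu> = sets M"
    and \<alpha>: "0 < \<alpha>"
    and \<nu>: "\<And>B. B \<in> sets M \<Longrightarrow> emeasure \<nu> B =
      ennreal \<alpha> * (\<integral>\<^sup>+t. emeasure \<pi> (sc t ` B) * ennreal (t powr (\<alpha> - 1)) \<partial>lborel_pos)"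
  shows "emeasure \<nu> (space M) \<noteq> 0 \<and> homogeneous sc \<alpha> \<nu>"
proof
  interpret \<pi>: prob_space \<pi> by fact
  note sf = \<pi>.sigma_finite_measure_axioms
  show "homogeneous sc \<alpha> \<nu>"
    unfolding homogeneous_def sets_\<nu>
    by (simp add: \<nu> scaled_set_in_sets nn_integral_scaled_scaled_set[OF sf sets_\<pi>] mult.left_commute)
  have invariant: "sc t ` space M = space M" if "0 < t" for t
    using that by (auto simp: mem_scaled_set_iff scaling_in_space)
  have "(\<integral>\<^sup>+t. emeasure \<pi> (sc t ` space M) * ennreal (t powr (\<alpha> - 1)) \<partial>lborel_pos) =
      (\<integral>\<^sup>+t\<in>{0<..}. ennreal (t powr (\<alpha> - 1)) \<partial>lborel)"
    unfolding nn_integral_lborel_pos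
    using invariant \<pi>.emeasure_space_1 sets_eq_imp_space_eq[OF sets_\<pi>]
    by (intro nn_integral_cong) (auto split: split_indicator)
  moreover have "(\<integral>\<^sup>+t\<in>{0<..}. ennreal (t powr (\<alpha> - 1)) \<partial>lborel) \<noteq> 0"
  proof
    assume "(\<integral>\<^sup>+t\<in>{0<..}. ennreal (t powr (\<alpha> - 1)) \<partial>lborel) = 0"
    then have "AE t in lborel. ennreal (t powr (\<alpha> - 1)) * indicator {0<..} t = 0"
      by (subst (asm) nn_integral_0_iff_AE) auto
    then have "AE t in lborel. t \<notin> {0<..<1::real}"
      by eventually_elim (auto split: split_indicator_asm)
    then have "{0<..<1::real} \<in> null_sets lborel"
      by (subst AE_iff_null_sets) auto
    then show False by (auto dest: null_setsD1)
  qed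
  ultimately show "emeasure \<nu> (space M) \<noteq> 0"
    using \<alpha> by (simp add: \<nu>)
qed

text \<open>
  The sets \<open>U k\<close> are merged into the single set \<open>\<Union>k. s k U k\<close>, where homogeneity allows the \<open>s k\<close> to be
  so large that its measure is finite.
\<close>

lemma (in scaling) exists_homogeneous_base:
  assumes \<alpha>: "0 < \<alpha>"
    and U: "\<And>k. U k \<in> sets M"
    and up: "\<And>k x t. x \<in> U k \<Longrightarrow> t \<ge> 1 \<Longrightarrow> sc t x \<in> U k"
    and cover: "(\<Union>k::nat. \<Union>t\<in>{0<..}. sc t ` U k) = space M"
    and sets: "sets \<nu> = sets M"
    and hom: "homogeneous sc \<alpha> \<nu>"
    and fin: "\<And>k. emeasure \<nu> (U k) < \<infinity>"
  shows "\<exists>V. homogeneous_base M sc \<nu> \<alpha> V"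
proof -
  note U_sub = sets.sets_into_space[OF U]
  define c where "c k = enn2real (emeasure \<nu> (U k))" for k
  have c: "0 \<le> c k" "emeasure \<nu> (U k) = ennreal (c k)" for k
    using fin[of k] by (auto simp: c_def)
  \<comment> \<open>With this choice the k-th scaled set has measure 2^(-k) c/(1+c) \<le> 2^(-k),
    which is summable. The summand 1 keeps the base positive when c = 0.\<close>
  define s where "s k = (2 ^ k * (1 + c k)) powr (1 / \<alpha>)" for k
  have base_pos: "0 < 2 ^ k * (1 + c k)" for k using c(1)[of k] by simp
  have s: "0 < s k" for k using base_pos[of k] unfolding s_def by (simp only: powr_gt_zero)
  have s_powr: "s k powr (-\<alpha>) = inverse (2 ^ k * (1 + c k))" for k
    using base_pos[of k] \<alpha> by (simp add: s_def powr_powr powr_minus del: inverse_mult_distrib)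
  define V where "V = (\<Union>k. sc (s k) ` U k)"
  have sU: "sc (s k) ` U k \<in> sets M" for k by (rule scaled_set_in_sets[OF s U])
  have "emeasure \<nu> (sc (s k) ` U k) \<le> ennreal ((1 / 2) ^ k)" for k
  proof -
    have "emeasure \<nu> (sc (s k) ` U k) = ennreal (s k powr (-\<alpha>)) * ennreal (c k)"
      using hom s U c(2) unfolding homogeneous_def sets by metis
    also have "\<dots> = ennreal ((1 / 2) ^ k * (c k / (1 + c k)))"
      using c(1)[of k] by (simp add: s_powr ennreal_mult[symmetric] field_simps)
    also have "\<dots> \<le> ennreal ((1 / 2) ^ k)"
      using c(1)[of k] by (intro ennreal_leI mult_left_le) (auto simp: field_simps)
    finally show ?thesis .
  qed
  then have "(\<Sum>k. emeasure \<nu> (sc (s k) ` U k)) \<le> (\<Sum>k. ennreal ((1 / 2) ^ k))"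
    by (intro suminf_le) auto
  also have "\<dots> < \<infinity>"
    by (subst suminf_ennreal2) (auto intro!: summable_geometric)
  finally have "(\<Sum>k. emeasure \<nu> (sc (s k) ` U k)) < \<infinity>" .
  moreover have "emeasure \<nu> V \<le> (\<Sum>k. emeasure \<nu> (sc (s k) ` U k))"
    unfolding V_def using sU sets by (intro emeasure_subadditive_countably) auto
  ultimately have V_finite: "emeasure \<nu> V < \<infinity>" by (rule le_less_trans[rotated])
  have "homogeneous_base M sc \<nu> \<alpha> V"
  proof unfold_locales
    show "V \<in> sets M" unfolding V_def using sU by auto
    show "sc t x \<in> V" if x: "x \<in> V" and t: "1 \<le> t" for x t
    proof -
      obtain k u where u: "u \<in> U k" "x = sc (s k) u" using x by (auto simp: V_def)
      then have "u \<in> space M" using U_sub by blast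
      then have "sc t x = sc (s k) (sc t u)"
        using u s[of k] t by (simp add: scaling_scaling mult.commute)
      then show ?thesis using up[OF u(1) t] by (auto simp: V_def)
    qed
    show "\<exists>t>0. sc t x \<in> V" if "x \<in> space M" for x
    proof -
      have "x \<in> (\<Union>k. \<Union>t\<in>{0<..}. sc t ` U k)" using that cover by simp
      then obtain k t u where t: "0 < t" and u: "u \<in> U k" "x = sc t u" by auto
      have "u \<in> space M" using u U_sub by blast
      \<comment> \<open>The factor 1/t undoes the scaling that led from u to x, and
        \<open>s k\<close> then moves u into V.\<close>
      then have "sc (s k * inverse t) x = sc (s k) u"
        using t s[of k] u by (simp add: scaling_scaling mult.assoc)
      then show ?thesis
        using u t s[of k] by (intro exI[of _ "s k * inverse t"]) (auto simp: V_def)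
    qed
  qed (fact sets hom \<alpha> V_finite)+
  then show ?thesis ..
qed

section \<open>Equivalence of the three descriptions\<close>

theorem proposition2p8:
  fixes M :: "'a measure" and sc :: "real \<Rightarrow> 'a \<Rightarrow> 'a" and \<alpha> :: real
    and U :: "nat \<Rightarrow> 'a set" and \<nu> :: "'a measure"
  assumes "scaling M sc"
    and "\<alpha> > 0"
    and "\<And>k. U k \<in> sets M"
    and "\<And>k x t. x \<in> U k \<Longrightarrow> t \<ge> 1 \<Longrightarrow> sc t x \<in> U k"
    and "(\<Union>k. \<Union>t\<in>{0<..}. sc t ` U k) = space M"
    and "sets \<nu> = sets M"
  defines "i \<equiv>
      emeasure \<nu> (space M) \<noteq> 0 \<and> homogeneous sc \<alpha> \<nu> \<and> (\<forall>k. emeasure \<nu> (U k) < \<infinity>)"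
    and "ii \<equiv> \<exists>\<pi>. prob_space \<pi> \<and> sets \<pi> = sets M \<and>
      (\<forall>k. (\<integral>\<^sup>+t\<in>{0<..}. emeasure \<pi> (sc t ` U k) * ennreal (t powr (\<alpha> - 1)) \<partial>lborel) < \<infinity>) \<and>
      \<nu> = distr (\<pi> \<Otimes>\<^sub>M theta \<alpha>) M (\<lambda>(x, t). sc t x)"
    and "iii \<equiv> \<exists>\<pi>. prob_space \<pi> \<and> sets \<pi> = sets M \<and>
      (\<forall>k. (\<integral>\<^sup>+t\<in>{0<..}. emeasure \<pi> (sc t ` U k) * ennreal (t powr (\<alpha> - 1)) \<partial>lborel) < \<infinity>) \<and>
      (\<forall>B\<in>sets M. emeasure \<nu> B =
        ennreal \<alpha> * (\<integral>\<^sup>+t\<in>{0<..}. emeasure \<pi> (sc t ` B) * ennreal (t powr (\<alpha> - 1)) \<partial>lborel))"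
  shows "(i \<longleftrightarrow> ii) \<and> (ii \<longleftrightarrow> iii)"
proof -
  interpret scaling M sc by fact
  note \<alpha> = \<open>\<alpha> > 0\<close> and U = assms(3) and sets_\<nu> = \<open>sets \<nu> = sets M\<close>
  let ?J = "\<lambda>\<pi> B. \<integral>\<^sup>+t. emeasure \<pi> (sc t ` B) * ennreal (t powr (\<alpha> - 1)) \<partial>lborel_pos"
  have iii_iff: "iii \<longleftrightarrow> (\<exists>\<pi>. prob_space \<pi> \<and> sets \<pi> = sets M \<and> (\<forall>k. ?J \<pi> (U k) < \<infinity>) \<and>
      (\<forall>B\<in>sets M. emeasure \<nu> B = ennreal \<alpha> * ?J \<pi> B))"
    unfolding iii_def nn_integral_lborel_pos ..
  \<comment> \<open>For a fixed \<pi> the conditions of (ii) and (iii) on \<nu> coincide, because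
    measures on the same sigma-algebra are equal once they agree on its sets.\<close>
  have push: "\<nu> = distr (\<pi> \<Otimes>\<^sub>M theta \<alpha>) M (\<lambda>(x, t). sc t x) \<longleftrightarrow>
      (\<forall>B\<in>sets M. emeasure \<nu> B = ennreal \<alpha> * ?J \<pi> B)"
    if "prob_space \<pi>" "sets \<pi> = sets M" for \<pi>
  proof -
    interpret \<pi>: prob_space \<pi> by fact
    note distr = emeasure_distr_action[OF \<pi>.sigma_finite_measure_axioms that(2) _ \<alpha>]
    show ?thesis
      using sets_\<nu> by (auto simp: distr intro!: measure_eqI)
  qed
  have "ii \<longleftrightarrow> iii"
    unfolding iii_iff ii_def nn_integral_lborel_pos[symmetric] using push by blast
  moreover have "i \<longleftrightarrow> iii"
  proof
    assume i
    then have nonzero: "emeasure \<nu> (space M) \<noteq> 0" and hom: "homogeneous sc \<alpha> \<nu>"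
      and fin: "emeasure \<nu> (U k) < \<infinity>" for k
      unfolding i_def by auto
    obtain V where "homogeneous_base M sc \<nu> \<alpha> V"
      using exists_homogeneous_base[OF \<alpha> U assms(4,5) sets_\<nu> hom fin] by blast
    then interpret homogeneous_base M sc \<nu> \<alpha> V .
    obtain \<pi> where \<pi>: "prob_space \<pi>" "sets \<pi> = sets M"
      "\<And>B. B \<in> sets M \<Longrightarrow> emeasure \<nu> B = ennreal \<alpha> * ?J \<pi> B"
      using exists_spectral_measure[OF nonzero] by blast
    \<comment> \<open>The formula at \<open>U k\<close> equates \<alpha> times this integral with a
      finite measure, and \<alpha> > 0.\<close>
    have "?J \<pi> (U k) < \<infinity>" for k
      using fin[of k] \<alpha> unfolding \<pi>(3)[OF U] by (auto simp: ennreal_mult_less_top)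
    then show iii unfolding iii_iff using \<pi> by blast
  next
    assume iii
    then obtain \<pi> where \<pi>: "prob_space \<pi>" "sets \<pi> = sets M" "\<And>k. ?J \<pi> (U k) < \<infinity>"
      "\<And>B. B \<in> sets M \<Longrightarrow> emeasure \<nu> B = ennreal \<alpha> * ?J \<pi> B"
      unfolding iii_iff by blast
    have "emeasure \<nu> (U k) < \<infinity>" for k
      using \<pi>(3)[of k] unfolding \<pi>(4)[OF U] by (auto simp: ennreal_mult_less_top)
    then show i
      unfolding i_def using homogeneous_of_spectral_measure[OF \<pi>(1,2) sets_\<nu> \<alpha> \<pi>(4)] by blast
  qed
  ultimately show ?thesis by blast
qed

end
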